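(* Let $G$ act on a group $K$ by automorphisms, let $d,d'\colon G\to K$ be derivations, viewed as elements of $H^1(G;K)$, and let $\delta\colon H^1(G;\mathrm{Inn}(K))\to H^2(G;Z(K))$ be the Brauer obstruction map. If $d$ and $d'$ map to the same class in $\ker\delta/Z(G)$, then $\mathrm{tc}(d)=\mathrm{tc}(d')$.
   Context: All groups are discrete; $G$ is written multiplicatively and $K$ additively (even though $K$ need not be abelian). If $G$ acts on $K$ by automorphisms, $(g,k)\mapsto g\cdot k$, the semi-direct product $K\rtimes G$ is the set $K\times G$ with $(k,g)(k',g')=(k+g\cdot k',gg')$, with projection $p(k,g)=g$. A derivation is a function $d\colon G\to K$ with $d(gh)=d(g)+g\cdot d(h)$; it determines the splitting $s_d(g)=(d(g),g)$ of $p$. A functorial classifying space construction gives a fibration $Bp\colon B(K\rtimes G)\to BG$ with fibre $BK$ and section $B(s_d)$. For a group $N$ with $G$-action, $H^1(G;N)$ is the pointed set of derivations $G\to N$ modulo the equivalence $d\sim d'$ iff there is $a\in N$ with $d'(g)=a+d(g)-g\cdot a$ for all $g\in G$. $Z(K)$ is the centre of $K$ and $\mathrm{Inn}(K)=K/Z(K)$ with the induced $G$-action; $q\colon K\to\mathrm{Inn}(K)$ is the quotient map, $q^*\colon H^1(G;K)\to H^1(G;\mathrm{Inn}(K))$ the induced map. The Brauer obstruction $\delta$ is the connecting map in the exact sequence of pointed sets $H^1(G;Z(K))\to H^1(G;K)\xrightarrow{q^*}H^1(G;\mathrm{Inn}(K))\xrightarrow{\delta}H^2(G;Z(K))$ (for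 a derivation $x$ with lift to a function $\tilde x\colon G\to K$, $\delta[x]$ is the class of $(g,h)\mapsto \tilde x(g)+g\cdot\tilde x(h)-\tilde x(gh)$); so $\ker\delta=\mathrm{Im}(q^* )$. The centre $Z(G)$ acts on $\mathrm{Inn}(K)$ by restriction of the $G$-action, hence on $H^1(G;\mathrm{Inn}(K))$ by $(z\cdot x)(g)=z\cdot x(g)$; $\ker\delta/Z(G)$ is the set of orbits of this action on $\ker\delta$, and derivations map to it via $q^*$. For a fibration $q\colon E\to Y$, the sectional category $\mathrm{secat}(q)$ is the minimal $n$ such that $Y$ has an open cover $U_0,\dots,U_n$ with each $U_i$ admitting a section $U_i\to E$ of $q$ ($\infty$ if there is no such $n$). For a fibration $r\colon X\to B$ with section $s\colon B\to X$, let $P_BX=\{\alpha\colon I\to X \text{ continuous}\mid r\circ\alpha \text{ constant},\ \alpha(0)=s(r(\alpha(0)))\}$ and $\mathrm{ev}_1\colon P_BX\to X$, $\alpha\mapsto\alpha(1)$. The complexity of $d$ is the $BG$-parametrized LS-category of $B(K\rtimes G)$ with respect to the section $B(s_d)$ of $Bp$, that is, $$\mathrm{tc}(d):=\mathrm{cat}_{BG}(B(K\rtimes G))=\mathrm{secat}\big(\mathrm{ev}_1\colon P_{BG}B(K\rtimes G)\to B(K\rtimes G)\big).$$ *)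

theory Defs
  imports "HOL-Algebra.Bij" "HOL-Algebra.Group_Action" "HOL-Algebra.Product_Groups"
    "HOL-Homology.Simplices" "HOL-Library.Extended_Nat"
begin

section \<open>Groups with action, derivations and cohomology in degrees one and two\<close>

text \<open>
  All groups, including the coefficient group \<open>K\<close>, are written multiplicatively, as in
  HOL-Algebra. An action of \<open>G\<close> on \<open>K\<close> by automorphisms is a homomorphism
  \<open>\<phi> \<in> hom G (AutoGroup K)\<close>; note that multiplication in \<^const>\<open>AutoGroup\<close> is
  composition \<open>f \<circ> g\<close>, so this is a left action \<open>g \<cdot> k = \<phi> g k\<close>.
\<close>

definition centre :: "('a, 'm) monoid_scheme \<Rightarrow> 'a set" where
  "centre G = {z \<in> carrier G. \<forall>g\<in>carrier G. z \<otimes>\<^bsub>G\<^esub> g = g \<otimes>\<^bsub>G\<^esub> z}"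

abbreviation centre_group :: "('a, 'm) monoid_scheme \<Rightarrow> ('a, 'm) monoid_scheme" where
  "centre_group G \<equiv> G\<lparr>carrier := centre G\<rparr>"

definition semidirect ::
  "('k, 'n) monoid_scheme \<Rightarrow> ('g, 'm) monoid_scheme \<Rightarrow> ('g \<Rightarrow> 'k \<Rightarrow> 'k) \<Rightarrow> ('k \<times> 'g) monoid" where
  "semidirect K G \<phi> =
     \<lparr>carrier = carrier K \<times> carrier G,
      monoid.mult = (\<lambda>(k, g) (k', g'). (k \<otimes>\<^bsub>K\<^esub> \<phi> g k', g \<otimes>\<^bsub>G\<^esub> g')),
      one = (\<one>\<^bsub>K\<^esub>, \<one>\<^bsub>G\<^esub>)\<rparr>"

text \<open>Derivations are extensional, so that each one is a function on \<open>carrier G\<close> only.\<close>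

definition derivations ::
  "('g, 'm) monoid_scheme \<Rightarrow> ('k, 'n) monoid_scheme \<Rightarrow> ('g \<Rightarrow> 'k \<Rightarrow> 'k) \<Rightarrow> ('g \<Rightarrow> 'k) set" where
  "derivations G N \<phi> = {d \<in> carrier G \<rightarrow>\<^sub>E carrier N.
     \<forall>g\<in>carrier G. \<forall>h\<in>carrier G. d (g \<otimes>\<^bsub>G\<^esub> h) = d g \<otimes>\<^bsub>N\<^esub> \<phi> g (d h)}"

definition derivation_rel ::
  "('g, 'm) monoid_scheme \<Rightarrow> ('k, 'n) monoid_scheme \<Rightarrow> ('g \<Rightarrow> 'k \<Rightarrow> 'k)
    \<Rightarrow> (('g \<Rightarrow> 'k) \<times> ('g \<Rightarrow> 'k)) set" where
  "derivation_rel G N \<phi> = {(d, d'). d \<in> derivations G N \<phi> \<and> d' \<in> derivations G N \<phi> \<and>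
     (\<exists>a\<in>carrier N. \<forall>g\<in>carrier G. d' g = a \<otimes>\<^bsub>N\<^esub> d g \<otimes>\<^bsub>N\<^esub> inv\<^bsub>N\<^esub> (\<phi> g a))}"

definition H1 ::
  "('g, 'm) monoid_scheme \<Rightarrow> ('k, 'n) monoid_scheme \<Rightarrow> ('g \<Rightarrow> 'k \<Rightarrow> 'k) \<Rightarrow> ('g \<Rightarrow> 'k) set set" where
  "H1 G N \<phi> = derivations G N \<phi> // derivation_rel G N \<phi>"

definition H1_class ::
  "('g, 'm) monoid_scheme \<Rightarrow> ('k, 'n) monoid_scheme \<Rightarrow> ('g \<Rightarrow> 'k \<Rightarrow> 'k) \<Rightarrow> ('g \<Rightarrow> 'k)
    \<Rightarrow> ('g \<Rightarrow> 'k) set" where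
  "H1_class G N \<phi> d = derivation_rel G N \<phi> `` {d}"

definition cocycles2 ::
  "('g, 'm) monoid_scheme \<Rightarrow> ('a, 'n) monoid_scheme \<Rightarrow> ('g \<Rightarrow> 'a \<Rightarrow> 'a)
    \<Rightarrow> ('g \<times> 'g \<Rightarrow> 'a) set" where
  "cocycles2 G A \<phi> = {c \<in> carrier G \<times> carrier G \<rightarrow>\<^sub>E carrier A.
     \<forall>g\<in>carrier G. \<forall>h\<in>carrier G. \<forall>k\<in>carrier G.
       \<phi> g (c (h, k)) \<otimes>\<^bsub>A\<^esub> c (g, h \<otimes>\<^bsub>G\<^esub> k) = c (g \<otimes>\<^bsub>G\<^esub> h, k) \<otimes>\<^bsub>A\<^esub> c (g, h)}"

text \<open>
  The function \<open>(g,h) \<mapsto> f(g) + g \<cdot> f(h) - f(gh)\<close>, for a function \<open>f\<close> on \<open>G\<close>; it is used both for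
  coboundaries and for the Brauer obstruction.
\<close>

definition derivation_defect ::
  "('g, 'm) monoid_scheme \<Rightarrow> ('a, 'n) monoid_scheme \<Rightarrow> ('g \<Rightarrow> 'a \<Rightarrow> 'a)
    \<Rightarrow> ('g \<Rightarrow> 'a) \<Rightarrow> 'g \<times> 'g \<Rightarrow> 'a" where
  "derivation_defect G A \<phi> f =
     (\<lambda>(g, h) \<in> carrier G \<times> carrier G. f g \<otimes>\<^bsub>A\<^esub> \<phi> g (f h) \<otimes>\<^bsub>A\<^esub> inv\<^bsub>A\<^esub> (f (g \<otimes>\<^bsub>G\<^esub> h)))"

definition coboundaries2 ::
  "('g, 'm) monoid_scheme \<Rightarrow> ('a, 'n) monoid_scheme \<Rightarrow> ('g \<Rightarrow> 'a \<Rightarrow> 'a)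
    \<Rightarrow> ('g \<times> 'g \<Rightarrow> 'a) set" where
  "coboundaries2 G A \<phi> = derivation_defect G A \<phi> ` (carrier G \<rightarrow>\<^sub>E carrier A)"

definition cocycle2_group ::
  "('g, 'm) monoid_scheme \<Rightarrow> ('a, 'n) monoid_scheme \<Rightarrow> ('g \<Rightarrow> 'a \<Rightarrow> 'a)
    \<Rightarrow> ('g \<times> 'g \<Rightarrow> 'a) monoid" where
  "cocycle2_group G A \<phi> =
     (product_group (carrier G \<times> carrier G) (\<lambda>_. A))\<lparr>carrier := cocycles2 G A \<phi>\<rparr>"

definition H2 ::
  "('g, 'm) monoid_scheme \<Rightarrow> ('a, 'n) monoid_scheme \<Rightarrow> ('g \<Rightarrow> 'a \<Rightarrow> 'a)
    \<Rightarrow> ('g \<times> 'g \<Rightarrow> 'a) set monoid" where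
  "H2 G A \<phi> = cocycle2_group G A \<phi> Mod coboundaries2 G A \<phi>"

definition H2_class ::
  "('g, 'm) monoid_scheme \<Rightarrow> ('a, 'n) monoid_scheme \<Rightarrow> ('g \<Rightarrow> 'a \<Rightarrow> 'a)
    \<Rightarrow> ('g \<times> 'g \<Rightarrow> 'a) \<Rightarrow> ('g \<times> 'g \<Rightarrow> 'a) set" where
  "H2_class G A \<phi> c = coboundaries2 G A \<phi> #>\<^bsub>cocycle2_group G A \<phi>\<^esub> c"


section \<open>The Brauer obstruction\<close>

definition Inn :: "('k, 'n) monoid_scheme \<Rightarrow> 'k set monoid" where
  "Inn K = K Mod centre K"

definition to_Inn :: "('k, 'n) monoid_scheme \<Rightarrow> 'k \<Rightarrow> 'k set" where
  "to_Inn K k = centre K #>\<^bsub>K\<^esub> k"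

definition Inn_action ::
  "('k, 'n) monoid_scheme \<Rightarrow> ('g \<Rightarrow> 'k \<Rightarrow> 'k) \<Rightarrow> 'g \<Rightarrow> 'k set \<Rightarrow> 'k set" where
  "Inn_action K \<phi> g = (\<lambda>C \<in> carrier (Inn K). \<phi> g ` C)"

definition centre_action ::
  "('k, 'n) monoid_scheme \<Rightarrow> ('g \<Rightarrow> 'k \<Rightarrow> 'k) \<Rightarrow> 'g \<Rightarrow> 'k \<Rightarrow> 'k" where
  "centre_action K \<phi> g = restrict (\<phi> g) (centre K)"

text \<open>
  Maps on cohomology classes are given as unions over all representatives (and all lifts); these
  are unions of equal sets.
\<close>

definition q_star ::
  "('g, 'm) monoid_scheme \<Rightarrow> ('k, 'n) monoid_scheme \<Rightarrow> ('g \<Rightarrow> 'k \<Rightarrow> 'k)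
    \<Rightarrow> ('g \<Rightarrow> 'k) set \<Rightarrow> ('g \<Rightarrow> 'k set) set" where
  "q_star G K \<phi> X =
     (\<Union>d\<in>X. H1_class G (Inn K) (Inn_action K \<phi>) (\<lambda>g\<in>carrier G. to_Inn K (d g)))"

definition lifts ::
  "('g, 'm) monoid_scheme \<Rightarrow> ('k, 'n) monoid_scheme \<Rightarrow> ('g \<Rightarrow> 'k set) \<Rightarrow> ('g \<Rightarrow> 'k) set" where
  "lifts G K x = {l \<in> carrier G \<rightarrow>\<^sub>E carrier K. \<forall>g\<in>carrier G. to_Inn K (l g) = x g}"

definition brauer ::
  "('g, 'm) monoid_scheme \<Rightarrow> ('k, 'n) monoid_scheme \<Rightarrow> ('g \<Rightarrow> 'k \<Rightarrow> 'k)
    \<Rightarrow> ('g \<Rightarrow> 'k set) set \<Rightarrow> ('g \<times> 'g \<Rightarrow> 'k) set" where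
  "brauer G K \<phi> X =
     (\<Union>x\<in>X. \<Union>l\<in>lifts G K x.
        H2_class G (centre_group K) (centre_action K \<phi>) (derivation_defect G K \<phi> l))"

definition ker_brauer ::
  "('g, 'm) monoid_scheme \<Rightarrow> ('k, 'n) monoid_scheme \<Rightarrow> ('g \<Rightarrow> 'k \<Rightarrow> 'k)
    \<Rightarrow> ('g \<Rightarrow> 'k set) set set" where
  "ker_brauer G K \<phi> = {X \<in> H1 G (Inn K) (Inn_action K \<phi>).
     brauer G K \<phi> X = \<one>\<^bsub>H2 G (centre_group K) (centre_action K \<phi>)\<^esub>}"

definition H1_centre_action ::
  "('g, 'm) monoid_scheme \<Rightarrow> ('n, 'l) monoid_scheme \<Rightarrow> ('g \<Rightarrow> 'n \<Rightarrow> 'n)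
    \<Rightarrow> 'g \<Rightarrow> ('g \<Rightarrow> 'n) set \<Rightarrow> ('g \<Rightarrow> 'n) set" where
  "H1_centre_action G N \<psi> z X = (\<Union>x\<in>X. H1_class G N \<psi> (\<lambda>g\<in>carrier G. \<psi> z (x g)))"

definition ker_brauer_mod_centre ::
  "('g, 'm) monoid_scheme \<Rightarrow> ('k, 'n) monoid_scheme \<Rightarrow> ('g \<Rightarrow> 'k \<Rightarrow> 'k)
    \<Rightarrow> ('g \<Rightarrow> 'k set) set set set" where
  "ker_brauer_mod_centre G K \<phi> =
     orbits (centre_group G) (ker_brauer G K \<phi>) (H1_centre_action G (Inn K) (Inn_action K \<phi>))"


section \<open>The bar construction of the classifying space\<close>

definition quotient_topology :: "'a topology \<Rightarrow> ('a \<Rightarrow> 'b) \<Rightarrow> 'b topology" where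
  "quotient_topology X f =
     topology (\<lambda>U. U \<subseteq> f ` topspace X \<and> openin X {x \<in> topspace X. f x \<in> U})"

lemma istopology_quotient:
  "istopology (\<lambda>U. U \<subseteq> f ` topspace X \<and> openin X {x \<in> topspace X. f x \<in> U})"
proof -
  have 1: "{x \<in> topspace X. f x \<in> S \<inter> T} =
      {x \<in> topspace X. f x \<in> S} \<inter> {x \<in> topspace X. f x \<in> T}" for S T
    by auto
  have 2: "{x \<in> topspace X. f x \<in> \<Union>\<K>} = (\<Union>S\<in>\<K>. {x \<in> topspace X. f x \<in> S})" for \<K>
    by auto
  show ?thesis
    unfolding istopology_def 1 2 by (auto intro!: openin_Union)
qed

lemma openin_quotient_topology:
  "openin (quotient_topology X f) U \<longleftrightarrow>
     U \<subseteq> f ` topspace X \<and> openin X {x \<in> topspace X. f x \<in> U}"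
  by (simp add: quotient_topology_def istopology_quotient topology_inverse')

lemma topspace_quotient_topology: "topspace (quotient_topology X f) = f ` topspace X"
proof
  show "topspace (quotient_topology X f) \<subseteq> f ` topspace X"
    using openin_topspace[of "quotient_topology X f"] unfolding openin_quotient_topology by blast
  have "{x \<in> topspace X. f x \<in> f ` topspace X} = topspace X"
    by auto
  then have "openin (quotient_topology X f) (f ` topspace X)"
    by (simp add: openin_quotient_topology)
  then show "f ` topspace X \<subseteq> topspace (quotient_topology X f)"
    by (rule openin_subset)
qed

lemma quotient_map_quotient_topology: "quotient_map X (quotient_topology X f) f"
  by (simp add: quotient_map_def topspace_quotient_topology openin_quotient_topology)

text \<open>
  The nerve of \<open>G\<close> has as \<open>n\<close>-simplices the lists \<open>[g\<^sub>1|\<dots>|g\<^sub>n]\<close> over \<open>G\<close>, and \<open>BG\<close> is its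
  geometric realization.
\<close>

definition nerve_face :: "('g, 'm) monoid_scheme \<Rightarrow> nat \<Rightarrow> 'g list \<Rightarrow> 'g list" where
  "nerve_face G i \<sigma> =
     (if i = 0 then tl \<sigma>
      else if i = length \<sigma> then butlast \<sigma>
      else take (i - 1) \<sigma> @ [\<sigma> ! (i - 1) \<otimes>\<^bsub>G\<^esub> \<sigma> ! i] @ drop (i + 1) \<sigma>)"

definition nerve_degeneracy :: "('g, 'm) monoid_scheme \<Rightarrow> nat \<Rightarrow> 'g list \<Rightarrow> 'g list" where
  "nerve_degeneracy G i \<sigma> = take i \<sigma> @ [\<one>\<^bsub>G\<^esub>] @ drop i \<sigma>"

text \<open>
  The coface maps of the standard simplices are \<^const>\<open>simplical_face\<close> from HOL-Homology.
\<close>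

definition simplex_codegeneracy :: "nat \<Rightarrow> (nat \<Rightarrow> real) \<Rightarrow> nat \<Rightarrow> real" where
  "simplex_codegeneracy i t =
     (\<lambda>j. if j < i then t j else if j = i then t i + t (Suc i) else t (Suc j))"

definition nerve_cells :: "('g, 'm) monoid_scheme \<Rightarrow> ('g list \<times> (nat \<Rightarrow> real)) topology" where
  "nerve_cells G =
     sum_topology (\<lambda>\<sigma>. subtopology (powertop_real UNIV) (standard_simplex (length \<sigma>)))
       (lists (carrier G))"

inductive realization_step ::
  "('g, 'm) monoid_scheme \<Rightarrow> 'g list \<times> (nat \<Rightarrow> real) \<Rightarrow> 'g list \<times> (nat \<Rightarrow> real) \<Rightarrow> bool"
  for G where
  face: "\<lbrakk>\<sigma> \<in> lists (carrier G); length \<sigma> = Suc n; i \<le> Suc n; t \<in> standard_simplex n\<rbrakk>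
    \<Longrightarrow> realization_step G (nerve_face G i \<sigma>, t) (\<sigma>, simplical_face i t)"
| degeneracy: "\<lbrakk>\<sigma> \<in> lists (carrier G); length \<sigma> = n; i \<le> n; t \<in> standard_simplex (Suc n)\<rbrakk>
    \<Longrightarrow> realization_step G (nerve_degeneracy G i \<sigma>, t) (\<sigma>, simplex_codegeneracy i t)"

definition realization_class ::
  "('g, 'm) monoid_scheme \<Rightarrow> 'g list \<times> (nat \<Rightarrow> real) \<Rightarrow> ('g list \<times> (nat \<Rightarrow> real)) set" where
  "realization_class G x = {y. equivclp (realization_step G) x y}"

definition classifying_space ::
  "('g, 'm) monoid_scheme \<Rightarrow> ('g list \<times> (nat \<Rightarrow> real)) set topology" where
  "classifying_space G = quotient_topology (nerve_cells G) (realization_class G)"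

text \<open>The map \<open>BG \<rightarrow> BH\<close> induced by a homomorphism \<open>f \<in> hom G H\<close>.\<close>

definition classifying_map ::
  "('h, 'm) monoid_scheme \<Rightarrow> ('g \<Rightarrow> 'h)
    \<Rightarrow> ('g list \<times> (nat \<Rightarrow> real)) set \<Rightarrow> ('h list \<times> (nat \<Rightarrow> real)) set" where
  "classifying_map H f X = (\<Union>(\<sigma>, t)\<in>X. realization_class H (map f \<sigma>, t))"


section \<open>Sectional category and parametrized LS-category\<close>

text \<open>The infimum of the empty set of extended naturals is \<open>\<infinity>\<close>.\<close>

definition secat :: "'e topology \<Rightarrow> 'y topology \<Rightarrow> ('e \<Rightarrow> 'y) \<Rightarrow> enat" where
  "secat E Y q = Inf {enat n | n. \<exists>U :: nat \<Rightarrow> 'y set.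
     topspace Y = (\<Union>i\<le>n. U i) \<and>
     (\<forall>i\<le>n. openin Y (U i) \<and>
       (\<exists>s. continuous_map (subtopology Y (U i)) E s \<and> (\<forall>y\<in>U i. q (s y) = y)))}"

definition compact_open_topology :: "'a topology \<Rightarrow> 'b topology \<Rightarrow> ('a \<Rightarrow> 'b) topology" where
  "compact_open_topology X Y =
     subtopology
       (topology_generated_by {{f. f ` C \<subseteq> U} | C U. compactin X C \<and> openin Y U})
       {f \<in> extensional (topspace X). continuous_map X Y f}"

text \<open>
  The space \<open>P\<^sub>B X\<close> for \<open>r : X \<rightarrow> B\<close> with section \<open>s\<close>; the base \<open>B\<close> enters only through \<open>r\<close>
  and \<open>s\<close>.
\<close>

definition fibrewise_path_space ::
  "'x topology \<Rightarrow> ('x \<Rightarrow> 'b) \<Rightarrow> ('b \<Rightarrow> 'x) \<Rightarrow> (real \<Rightarrow> 'x) topology" where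
  "fibrewise_path_space X r s =
     subtopology (compact_open_topology (top_of_set {0..1}) X)
       {\<alpha>. (\<forall>t\<in>{0..1}. r (\<alpha> t) = r (\<alpha> 0)) \<and> \<alpha> 0 = s (r (\<alpha> 0))}"

definition parametrized_cat :: "'x topology \<Rightarrow> ('x \<Rightarrow> 'b) \<Rightarrow> ('b \<Rightarrow> 'x) \<Rightarrow> enat" where
  "parametrized_cat X r s = secat (fibrewise_path_space X r s) X (\<lambda>\<alpha>. \<alpha> 1)"

definition tc ::
  "('g, 'm) monoid_scheme \<Rightarrow> ('k, 'n) monoid_scheme \<Rightarrow> ('g \<Rightarrow> 'k \<Rightarrow> 'k) \<Rightarrow> ('g \<Rightarrow> 'k) \<Rightarrow> enat" where
  "tc G K \<phi> d =
     parametrized_cat (classifying_space (semidirect K G \<phi>))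
       (classifying_map G snd)
       (classifying_map (semidirect K G \<phi>) (\<lambda>g. (d g, g)))"

end

theory Submission
  imports Defs
begin

text \<open>
  The complexity \<open>tc(d)\<close> depends only on the space \<open>B(K \<rtimes> G)\<close> over \<open>BG\<close> together with the section
  \<open>B(s\<^sub>d)\<close>. So it suffices to find an automorphism \<open>F\<close> of \<open>K \<rtimes> G\<close> over \<open>G\<close> with
  \<open>F \<circ> s\<^sub>d = s\<^sub>d\<^sub>'\<close>: then \<open>BF\<close> is a homeomorphism over \<open>BG\<close> that carries one section to the other.

  Such an \<open>F\<close> comes from two observations. First, \<open>Z(G)\<close> acts trivially on \<open>H\<^sup>1(G; N)\<close> for every
  group \<open>N\<close> with \<open>G\<close>-action (\<open>centre_acts_trivially_on_H1\<close>): comparing \<open>x(zg)\<close> with \<open>x(gz)\<close> shows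
  that \<open>z \<cdot> x\<close> is cohomologous to \<open>x\<close> through \<open>x(z)\<inverse>\<close>. The orbits of \<open>Z(G)\<close> are therefore
  singletons, and the hypothesis says that \<open>q d\<close> and \<open>q d'\<close> have the same class in
  \<open>H\<^sup>1(G; Inn K)\<close>. Secondly, choosing \<open>c \<in> K\<close> so that \<open>q(c)\<close> is a coboundary between them and
  comparing lifts gives
  \<open>d'(g) = c d(g) \<zeta>(g) (g \<cdot> c)\<inverse>\<close> with \<open>\<zeta>\<close> a derivation with values in \<open>Z(K)\<close>
  (\<open>derivation_rel_Inn_central_factor\<close>). Multiplication by a central derivation and conjugation by
  \<open>(c, 1)\<close> are both automorphisms of \<open>K \<rtimes> G\<close> over \<open>G\<close>, and the composite
  \<open>F(k, g) = (c k \<zeta>(g) (g \<cdot> c)\<inverse>, g)\<close> sends \<open>(d(g), g)\<close> to \<open>(d'(g), g)\<close>.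

  On the topological side, a homomorphism of groups induces a continuous map of bar constructions,
  functorially, and postcomposition with a map over the base that respects the sections transports
  local sections of \<open>ev\<^sub>1\<close> (\<open>parametrized_cat_le_of_domination\<close>).
\<close>

section \<open>Groups with an action by automorphisms\<close>

context group
begin

lemma inv_mult_cancel: "\<lbrakk>x \<in> carrier G; y \<in> carrier G\<rbrakk> \<Longrightarrow> inv x \<otimes> (x \<otimes> y) = y"
  by (simp flip: m_assoc)

lemma mult_inv_cancel: "\<lbrakk>x \<in> carrier G; y \<in> carrier G\<rbrakk> \<Longrightarrow> x \<otimes> (inv x \<otimes> y) = y"
  by (simp flip: m_assoc)

lemma centre_closed: "z \<in> centre G \<Longrightarrow> z \<in> carrier G"
  by (simp add: centre_def)

lemma centre_commute: "\<lbrakk>z \<in> centre G; x \<in> carrier G\<rbrakk> \<Longrightarrow> z \<otimes> x = x \<otimes> z"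
  by (simp add: centre_def)

lemma centre_inv:
  assumes z: "z \<in> centre G"
  shows "inv z \<in> centre G"
proof -
  have zG: "z \<in> carrier G"
    by (rule centre_closed[OF z])
  have "inv z \<otimes> x = x \<otimes> inv z" if x: "x \<in> carrier G" for x
  proof -
    have "inv z \<otimes> x = inv z \<otimes> (x \<otimes> z) \<otimes> inv z"
      using x zG by (simp add: m_assoc)
    also have "\<dots> = x \<otimes> inv z"
      using x zG by (simp add: inv_mult_cancel flip: centre_commute[OF z])
    finally show ?thesis .
  qed
  then show ?thesis
    using zG by (simp add: centre_def)
qed

lemma subgroup_centre: "subgroup (centre G) G"
proof
  show "x \<otimes> y \<in> centre G" if x: "x \<in> centre G" and y: "y \<in> centre G" for x y
  proof -
    have xy: "x \<in> carrier G" "y \<in> carrier G"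
      using x y centre_closed by auto
    have "x \<otimes> y \<otimes> g = g \<otimes> (x \<otimes> y)" if g: "g \<in> carrier G" for g
    proof -
      have "x \<otimes> y \<otimes> g = x \<otimes> g \<otimes> y"
        using xy g centre_commute[OF y g] by (simp add: m_assoc)
      also have "\<dots> = g \<otimes> (x \<otimes> y)"
        using xy g centre_commute[OF x g] by (simp add: m_assoc)
      finally show ?thesis .
    qed
    then show ?thesis
      using xy by (simp add: centre_def)
  qed
  show "centre G \<subseteq> carrier G"
    by (auto simp: centre_closed)
  show "\<one> \<in> centre G"
    by (simp add: centre_def)
qed (rule centre_inv)

lemma normal_centre: "centre G \<lhd> G"
proof (rule normal_invI[OF subgroup_centre])
  show "x \<otimes> z \<otimes> inv x \<in> centre G" if x: "x \<in> carrier G" and z: "z \<in> centre G" for x z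
  proof -
    have "x \<otimes> z \<otimes> inv x = z"
      using x centre_closed[OF z] centre_commute[OF z x, symmetric] by (simp add: m_assoc)
    then show ?thesis
      using z by simp
  qed
qed

lemma group_Inn: "group (Inn G)"
  unfolding Inn_def by (rule normal.factorgroup_is_group[OF normal_centre])

lemma to_Inn_hom: "to_Inn G \<in> hom G (Inn G)"
  unfolding Inn_def to_Inn_def[abs_def] by (rule normal.r_coset_hom_Mod[OF normal_centre])

lemma carrier_Inn: "carrier (Inn G) = to_Inn G ` carrier G"
  by (auto simp: Inn_def FactGroup_def RCOSETS_def to_Inn_def)

lemma to_Inn_eqD:
  assumes "to_Inn G x = to_Inn G y" and "x \<in> carrier G" and "y \<in> carrier G"
  shows "\<exists>z\<in>centre G. x = z \<otimes> y"
proof -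
  have "x \<in> centre G #> y"
    using assms rcos_self[OF assms(2) subgroup_centre] by (simp add: to_Inn_def)
  then show ?thesis
    by (auto simp: r_coset_def)
qed

end

locale group_acting_on_group = G: group G + K: group K
  for G :: "('g, 'm) monoid_scheme" (structure)
    and K :: "('k, 'n) monoid_scheme" (structure) +
  fixes \<phi> :: "'g \<Rightarrow> 'k \<Rightarrow> 'k"
  assumes action: "\<phi> \<in> hom G (AutoGroup K)"
begin

lemma act_auto: "g \<in> carrier G \<Longrightarrow> \<phi> g \<in> auto K"
  using hom_in_carrier[OF action] by (simp add: AutoGroup_def)

lemma act_hom: "g \<in> carrier G \<Longrightarrow> \<phi> g \<in> hom K K"
  using act_auto by (auto simp: auto_def)

lemma act_closed [simp, intro]: "\<lbrakk>g \<in> carrier G; k \<in> carrier K\<rbrakk> \<Longrightarrow> \<phi> g k \<in> carrier K"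
  by (rule hom_in_carrier[OF act_hom])

lemma act_mult:
  "\<lbrakk>g \<in> carrier G; k \<in> carrier K; l \<in> carrier K\<rbrakk> \<Longrightarrow> \<phi> g (k \<otimes>\<^bsub>K\<^esub> l) = \<phi> g k \<otimes>\<^bsub>K\<^esub> \<phi> g l"
  by (rule hom_mult[OF act_hom])

lemma act_unit [simp]: "g \<in> carrier G \<Longrightarrow> \<phi> g \<one>\<^bsub>K\<^esub> = \<one>\<^bsub>K\<^esub>"
  by (rule hom_one[OF act_hom K.group_axioms K.group_axioms])

lemma act_inv: "\<lbrakk>g \<in> carrier G; k \<in> carrier K\<rbrakk> \<Longrightarrow> \<phi> g (inv\<^bsub>K\<^esub> k) = inv\<^bsub>K\<^esub> (\<phi> g k)"
  by (rule group_hom.hom_inv) (auto simp: group_hom_def group_hom_axioms_def act_hom K.group_axioms)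

lemma act_comp:
  assumes "g \<in> carrier G" "h \<in> carrier G" "k \<in> carrier K"
  shows "\<phi> (g \<otimes>\<^bsub>G\<^esub> h) k = \<phi> g (\<phi> h k)"
proof -
  have "\<phi> g \<in> Bij (carrier K)" "\<phi> h \<in> Bij (carrier K)"
    using assms act_auto by (auto simp: auto_def)
  then show ?thesis
    using hom_mult[OF action assms(1,2)] assms(3)
    by (simp add: AutoGroup_def BijGroup_def compose_def)
qed

lemma act_one [simp]:
  assumes "k \<in> carrier K"
  shows "\<phi> \<one>\<^bsub>G\<^esub> k = k"
  using hom_one[OF action G.group_axioms K.AutoGroup] assms
  by (simp add: AutoGroup_def BijGroup_def)

lemma act_inv_cancel [simp]:
  assumes "g \<in> carrier G" "k \<in> carrier K"
  shows "\<phi> g (\<phi> (inv\<^bsub>G\<^esub> g) k) = k" "\<phi> (inv\<^bsub>G\<^esub> g) (\<phi> g k) = k"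
  using assms by (simp_all flip: act_comp)

lemma derivation_closed:
  "\<lbrakk>d \<in> derivations G K \<phi>; g \<in> carrier G\<rbrakk> \<Longrightarrow> d g \<in> carrier K"
  by (auto simp: derivations_def)

lemma derivation_mult:
  "\<lbrakk>d \<in> derivations G K \<phi>; g \<in> carrier G; h \<in> carrier G\<rbrakk>
    \<Longrightarrow> d (g \<otimes>\<^bsub>G\<^esub> h) = d g \<otimes>\<^bsub>K\<^esub> \<phi> g (d h)"
  by (auto simp: derivations_def)

lemma equiv_derivation_rel: "equiv (derivations G K \<phi>) (derivation_rel G K \<phi>)"
proof (rule equivI)
  show "derivation_rel G K \<phi> \<subseteq> derivations G K \<phi> \<times> derivations G K \<phi>"
    by (auto simp: derivation_rel_def)
  show "refl_on (derivations G K \<phi>) (derivation_rel G K \<phi>)"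
    by (rule refl_onI) (auto simp: derivation_rel_def derivation_closed intro!: bexI[of _ "\<one>\<^bsub>K\<^esub>"])
  show "sym (derivation_rel G K \<phi>)"
  proof (rule symI)
    fix d e assume "(d, e) \<in> derivation_rel G K \<phi>"
    then obtain a where D: "d \<in> derivations G K \<phi>" "e \<in> derivations G K \<phi>" and a: "a \<in> carrier K"
      and e: "\<And>g. g \<in> carrier G \<Longrightarrow> e g = a \<otimes>\<^bsub>K\<^esub> d g \<otimes>\<^bsub>K\<^esub> inv\<^bsub>K\<^esub> (\<phi> g a)"
      by (auto simp: derivation_rel_def)
    have "d g = inv\<^bsub>K\<^esub> a \<otimes>\<^bsub>K\<^esub> e g \<otimes>\<^bsub>K\<^esub> inv\<^bsub>K\<^esub> (\<phi> g (inv\<^bsub>K\<^esub> a))" if "g \<in> carrier G" for g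
      using that a D by (simp add: e derivation_closed act_inv K.m_assoc K.inv_mult_cancel)
    then show "(e, d) \<in> derivation_rel G K \<phi>"
      using D a by (auto simp: derivation_rel_def intro!: bexI[of _ "inv\<^bsub>K\<^esub> a"])
  qed
  show "trans (derivation_rel G K \<phi>)"
  proof (rule transI)
    fix d e f assume "(d, e) \<in> derivation_rel G K \<phi>" "(e, f) \<in> derivation_rel G K \<phi>"
    then obtain a b where D: "d \<in> derivations G K \<phi>" "f \<in> derivations G K \<phi>"
      and ab: "a \<in> carrier K" "b \<in> carrier K"
      and e: "\<And>g. g \<in> carrier G \<Longrightarrow> e g = a \<otimes>\<^bsub>K\<^esub> d g \<otimes>\<^bsub>K\<^esub> inv\<^bsub>K\<^esub> (\<phi> g a)"
      and f: "\<And>g. g \<in> carrier G \<Longrightarrow> f g = b \<otimes>\<^bsub>K\<^esub> e g \<otimes>\<^bsub>K\<^esub> inv\<^bsub>K\<^esub> (\<phi> g b)"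
      by (auto simp: derivation_rel_def)
    have "f g = (b \<otimes>\<^bsub>K\<^esub> a) \<otimes>\<^bsub>K\<^esub> d g \<otimes>\<^bsub>K\<^esub> inv\<^bsub>K\<^esub> (\<phi> g (b \<otimes>\<^bsub>K\<^esub> a))" if "g \<in> carrier G" for g
      using that ab D by (simp add: e f derivation_closed act_mult K.inv_mult_group K.m_assoc)
    then show "(d, f) \<in> derivation_rel G K \<phi>"
      using D ab by (auto simp: derivation_rel_def intro!: bexI[of _ "b \<otimes>\<^bsub>K\<^esub> a"])
  qed
qed

text \<open>
  Expanding \<open>x (z g) = x (g z)\<close> on both sides gives \<open>z \<cdot> x(g) = x(z)\<inverse> x(g) (g \<cdot> x(z))\<close>, so
  translating a derivation by a central element \<open>z\<close> is the coboundary change by \<open>x(z)\<inverse>\<close>.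
\<close>

lemma centre_translate_derivation_rel:
  assumes z: "z \<in> centre G" and x: "x \<in> derivations G K \<phi>"
  shows "(x, \<lambda>g\<in>carrier G. \<phi> z (x g)) \<in> derivation_rel G K \<phi>"
proof -
  have zG: "z \<in> carrier G" and comm: "\<And>g. g \<in> carrier G \<Longrightarrow> z \<otimes>\<^bsub>G\<^esub> g = g \<otimes>\<^bsub>G\<^esub> z"
    using z G.centre_closed G.centre_commute by auto
  have "\<phi> z (\<phi> g k) = \<phi> g (\<phi> z k)" if "g \<in> carrier G" "k \<in> carrier K" for g k
    using that zG comm[of g] by (simp flip: act_comp)
  then have y: "(\<lambda>g\<in>carrier G. \<phi> z (x g)) \<in> derivations G K \<phi>"
    using x zG by (auto simp: derivations_def act_mult Pi_def PiE_def)
  have "\<phi> z (x g) = inv\<^bsub>K\<^esub> (x z) \<otimes>\<^bsub>K\<^esub> x g \<otimes>\<^bsub>K\<^esub> inv\<^bsub>K\<^esub> (\<phi> g (inv\<^bsub>K\<^esub> (x z)))"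
    if g: "g \<in> carrier G" for g
  proof -
    have "x z \<otimes>\<^bsub>K\<^esub> \<phi> z (x g) = x g \<otimes>\<^bsub>K\<^esub> \<phi> g (x z)"
      using derivation_mult[OF x zG g] derivation_mult[OF x g zG] comm[OF g] by simp
    then have "\<phi> z (x g) = inv\<^bsub>K\<^esub> (x z) \<otimes>\<^bsub>K\<^esub> (x g \<otimes>\<^bsub>K\<^esub> \<phi> g (x z))"
      using x g zG by (metis K.inv_mult_cancel act_closed derivation_closed)
    then show ?thesis
      using x g zG by (simp add: act_inv K.m_assoc derivation_closed)
  qed
  then show ?thesis
    using x y zG by (auto simp: derivation_rel_def derivation_closed intro!: bexI[of _ "inv\<^bsub>K\<^esub> (x z)"])
qed

corollary centre_acts_trivially_on_H1:
  assumes z: "z \<in> centre G" and X: "X \<in> H1 G K \<phi>"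
  shows "H1_centre_action G K \<phi> z X = X"
proof -
  obtain x\<^sub>0 where x0: "x\<^sub>0 \<in> derivations G K \<phi>" and X_eq: "X = derivation_rel G K \<phi> `` {x\<^sub>0}"
    using X by (auto simp: H1_def elim: quotientE)
  have "H1_class G K \<phi> (\<lambda>g\<in>carrier G. \<phi> z (x g)) = X" if "x \<in> X" for x
  proof -
    have "(x\<^sub>0, x) \<in> derivation_rel G K \<phi>" "x \<in> derivations G K \<phi>"
      using that X_eq by (auto simp: derivation_rel_def)
    then have "(x\<^sub>0, \<lambda>g\<in>carrier G. \<phi> z (x g)) \<in> derivation_rel G K \<phi>"
      using centre_translate_derivation_rel[OF z] equiv_derivation_rel
      by (meson equivE transD)
    then show ?thesis
      unfolding H1_class_def X_eq by (rule equiv_class_eq[OF equiv_derivation_rel, symmetric])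
  qed
  moreover have "x\<^sub>0 \<in> X"
    using x0 X_eq equiv_class_self[OF equiv_derivation_rel] by simp
  ultimately show ?thesis
    by (auto simp: H1_centre_action_def)
qed

lemma act_centre:
  assumes g: "g \<in> carrier G" and z: "z \<in> centre K"
  shows "\<phi> g z \<in> centre K"
proof -
  have "\<phi> g z \<otimes>\<^bsub>K\<^esub> k = k \<otimes>\<^bsub>K\<^esub> \<phi> g z" if k: "k \<in> carrier K" for k
  proof -
    have "\<phi> g (z \<otimes>\<^bsub>K\<^esub> \<phi> (inv\<^bsub>G\<^esub> g) k) = \<phi> g (\<phi> (inv\<^bsub>G\<^esub> g) k \<otimes>\<^bsub>K\<^esub> z)"
      using K.centre_commute[OF z, of "\<phi> (inv\<^bsub>G\<^esub> g) k"] g k by simp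
    then show ?thesis
      using g z k by (simp add: act_mult K.centre_closed)
  qed
  then show ?thesis
    using g K.centre_closed[OF z] by (simp add: centre_def)
qed

text \<open>
  The \<open>G\<close>-action preserves the centre, so it maps cosets of the centre onto cosets; surjectivity
  onto the target coset uses the action of \<open>g\<inverse>\<close> on the centre.
\<close>

lemma Inn_action_to_Inn:
  assumes g: "g \<in> carrier G" and k: "k \<in> carrier K"
  shows "Inn_action K \<phi> g (to_Inn K k) = to_Inn K (\<phi> g k)"
proof -
  have "\<phi> g ` (centre K #>\<^bsub>K\<^esub> k) = centre K #>\<^bsub>K\<^esub> \<phi> g k"
  proof (intro equalityI subsetI)
    fix y assume "y \<in> \<phi> g ` (centre K #>\<^bsub>K\<^esub> k)"
    then show "y \<in> centre K #>\<^bsub>K\<^esub> \<phi> g k"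
      using g k by (auto simp: r_coset_def act_mult act_centre K.centre_closed)
  next
    fix y assume "y \<in> centre K #>\<^bsub>K\<^esub> \<phi> g k"
    then obtain z where z: "z \<in> centre K" and y: "y = z \<otimes>\<^bsub>K\<^esub> \<phi> g k"
      by (auto simp: r_coset_def)
    have "y = \<phi> g (\<phi> (inv\<^bsub>G\<^esub> g) z \<otimes>\<^bsub>K\<^esub> k)"
      using g k z by (simp add: y act_mult K.centre_closed)
    moreover have "\<phi> (inv\<^bsub>G\<^esub> g) z \<in> centre K"
      using g z by (simp add: act_centre)
    ultimately show "y \<in> \<phi> g ` (centre K #>\<^bsub>K\<^esub> k)"
      by (auto simp: r_coset_def)
  qed
  then show ?thesis
    using k by (simp add: Inn_action_def K.carrier_Inn to_Inn_def)
qed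

lemma to_Inn_closed: "k \<in> carrier K \<Longrightarrow> to_Inn K k \<in> carrier (Inn K)"
  by (rule hom_in_carrier[OF K.to_Inn_hom])

lemma Inn_action_hom: "Inn_action K \<phi> \<in> hom G (AutoGroup (Inn K))"
proof -
  have closed: "Inn_action K \<phi> g x \<in> carrier (Inn K)"
    if "g \<in> carrier G" "x \<in> carrier (Inn K)" for g x
  proof -
    obtain k where "k \<in> carrier K" "x = to_Inn K k"
      using \<open>x \<in> carrier (Inn K)\<close> by (auto simp: K.carrier_Inn)
    then show ?thesis
      using \<open>g \<in> carrier G\<close> by (simp add: Inn_action_to_Inn to_Inn_closed)
  qed
  have inverse: "Inn_action K \<phi> g (Inn_action K \<phi> (inv\<^bsub>G\<^esub> g) x) = x"
    "Inn_action K \<phi> (inv\<^bsub>G\<^esub> g) (Inn_action K \<phi> g x) = x"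
    if "g \<in> carrier G" "x \<in> carrier (Inn K)" for g x
    using that by (auto simp: K.carrier_Inn Inn_action_to_Inn)
  have Bij: "Inn_action K \<phi> g \<in> Bij (carrier (Inn K))" if g: "g \<in> carrier G" for g
  proof -
    have "bij_betw (Inn_action K \<phi> g) (carrier (Inn K)) (carrier (Inn K))"
      by (rule bij_betw_byWitness[where f' = "Inn_action K \<phi> (inv\<^bsub>G\<^esub> g)"])
        (use g in \<open>auto simp: closed inverse\<close>)
    then show ?thesis
      by (simp add: Bij_def Inn_action_def[of K \<phi> g])
  qed
  have mult: "Inn_action K \<phi> g (x \<otimes>\<^bsub>Inn K\<^esub> y) = Inn_action K \<phi> g x \<otimes>\<^bsub>Inn K\<^esub> Inn_action K \<phi> g y"
    if "g \<in> carrier G" "x \<in> carrier (Inn K)" "y \<in> carrier (Inn K)" for g x y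
    using that
    by (auto simp: K.carrier_Inn Inn_action_to_Inn act_mult simp flip: hom_mult[OF K.to_Inn_hom])
  have auto: "Inn_action K \<phi> g \<in> auto (Inn K)" if "g \<in> carrier G" for g
    using that closed mult Bij by (auto simp: auto_def hom_def)
  have "Inn_action K \<phi> (g \<otimes>\<^bsub>G\<^esub> h) = compose (carrier (Inn K)) (Inn_action K \<phi> g) (Inn_action K \<phi> h)"
    if "g \<in> carrier G" "h \<in> carrier G" for g h
  proof (rule extensionalityI)
    show "Inn_action K \<phi> (g \<otimes>\<^bsub>G\<^esub> h) \<in> extensional (carrier (Inn K))"
      by (simp add: Inn_action_def)
    show "Inn_action K \<phi> (g \<otimes>\<^bsub>G\<^esub> h) x = compose (carrier (Inn K)) (Inn_action K \<phi> g) (Inn_action K \<phi> h) x"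
      if "x \<in> carrier (Inn K)" for x
      using that \<open>g \<in> carrier G\<close> \<open>h \<in> carrier G\<close> closed
      by (auto simp: compose_eq K.carrier_Inn Inn_action_to_Inn act_comp)
  qed (simp add: compose_def)
  then show ?thesis
    using auto Bij by (auto simp: hom_def AutoGroup_def BijGroup_def)
qed

lemma group_acting_on_Inn: "group_acting_on_group G (Inn K) (Inn_action K \<phi>)"
  by (intro group_acting_on_group.intro G.group_axioms K.group_Inn
      group_acting_on_group_axioms.intro Inn_action_hom)

lemma to_Inn_derivation:
  assumes "d \<in> derivations G K \<phi>"
  shows "(\<lambda>g\<in>carrier G. to_Inn K (d g)) \<in> derivations G (Inn K) (Inn_action K \<phi>)"
proof -
  have "to_Inn K (d (g \<otimes>\<^bsub>G\<^esub> h)) = to_Inn K (d g) \<otimes>\<^bsub>Inn K\<^esub> Inn_action K \<phi> g (to_Inn K (d h))"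
    if "g \<in> carrier G" "h \<in> carrier G" for g h
    using that derivation_closed[OF assms]
    by (simp add: derivation_mult[OF assms] Inn_action_to_Inn hom_mult[OF K.to_Inn_hom])
  then show ?thesis
    using derivation_closed[OF assms] by (simp add: derivations_def to_Inn_closed)
qed

text \<open>
  The orbits of \<open>Z(G)\<close> on \<open>H\<^sup>1(G; Inn K)\<close> are singletons, so the image of a derivation in the orbit
  set determines its class in \<open>H\<^sup>1(G; Inn K)\<close>.
\<close>

lemma same_orbit_imp_derivation_rel_Inn:
  assumes d: "d \<in> derivations G K \<phi>" "d' \<in> derivations G K \<phi>"
    and \<Omega>: "\<Omega> \<in> ker_brauer_mod_centre G K \<phi>"
      "q_star G K \<phi> (H1_class G K \<phi> d) \<in> \<Omega>" "q_star G K \<phi> (H1_class G K \<phi> d') \<in> \<Omega>"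
  shows "(\<lambda>g\<in>carrier G. to_Inn K (d g), \<lambda>g\<in>carrier G. to_Inn K (d' g))
    \<in> derivation_rel G (Inn K) (Inn_action K \<phi>)"
proof -
  interpret Inn: group_acting_on_group G "Inn K" "Inn_action K \<phi>"
    by (rule group_acting_on_Inn)
  obtain X where X: "X \<in> H1 G (Inn K) (Inn_action K \<phi>)"
    and \<Omega>_eq: "\<Omega> = {H1_centre_action G (Inn K) (Inn_action K \<phi>) z X | z. z \<in> centre G}"
    using \<Omega>(1) by (auto simp: ker_brauer_mod_centre_def orbits_def orbit_def ker_brauer_def)
  have "\<Omega> \<subseteq> {X}"
    using Inn.centre_acts_trivially_on_H1 X by (auto simp: \<Omega>_eq)
  then have "q_star G K \<phi> (H1_class G K \<phi> d) = X" "q_star G K \<phi> (H1_class G K \<phi> d') = X"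
    using \<Omega>(2,3) by auto
  moreover have "(\<lambda>g\<in>carrier G. to_Inn K (e g)) \<in> q_star G K \<phi> (H1_class G K \<phi> e)"
    if "e \<in> derivations G K \<phi>" for e
    using equiv_class_self[OF equiv_derivation_rel that]
      equiv_class_self[OF Inn.equiv_derivation_rel to_Inn_derivation[OF that]]
    by (auto simp: q_star_def H1_class_def)
  ultimately show ?thesis
    using in_quotient_imp_in_rel[OF Inn.equiv_derivation_rel X[unfolded H1_def]] d by blast
qed

section \<open>Automorphisms of the semidirect product over the quotient\<close>

text \<open>
  This is the composite of two automorphisms of \<open>K \<rtimes> G\<close> over \<open>G\<close>: the shear
  \<open>(k, g) \<mapsto> (k \<zeta>(g), g)\<close> along a derivation \<open>\<zeta>\<close> with central values, and conjugation by \<open>(c, 1)\<close>.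
\<close>

definition twist :: "'k \<Rightarrow> ('g \<Rightarrow> 'k) \<Rightarrow> 'k \<times> 'g \<Rightarrow> 'k \<times> 'g" where
  "twist c \<zeta> = (\<lambda>(k, g). (c \<otimes>\<^bsub>K\<^esub> k \<otimes>\<^bsub>K\<^esub> \<zeta> g \<otimes>\<^bsub>K\<^esub> inv\<^bsub>K\<^esub> (\<phi> g c), g))"

lemma twist_hom:
  assumes c: "c \<in> carrier K"
    and \<zeta>: "\<And>g. g \<in> carrier G \<Longrightarrow> \<zeta> g \<in> centre K"
    and \<zeta>_mult: "\<And>g h. \<lbrakk>g \<in> carrier G; h \<in> carrier G\<rbrakk> \<Longrightarrow> \<zeta> (g \<otimes>\<^bsub>G\<^esub> h) = \<zeta> g \<otimes>\<^bsub>K\<^esub> \<phi> g (\<zeta> h)"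
  shows "twist c \<zeta> \<in> hom (semidirect K G \<phi>) (semidirect K G \<phi>)"
proof (rule homI)
  note \<zeta>_closed = K.centre_closed[OF \<zeta>]
  show "twist c \<zeta> x \<in> carrier (semidirect K G \<phi>)" if "x \<in> carrier (semidirect K G \<phi>)" for x
    using that c by (auto simp: twist_def semidirect_def \<zeta>_closed)
  have "c \<otimes>\<^bsub>K\<^esub> (k \<otimes>\<^bsub>K\<^esub> \<phi> g l) \<otimes>\<^bsub>K\<^esub> \<zeta> (g \<otimes>\<^bsub>G\<^esub> h) \<otimes>\<^bsub>K\<^esub> inv\<^bsub>K\<^esub> (\<phi> (g \<otimes>\<^bsub>G\<^esub> h) c)
      = (c \<otimes>\<^bsub>K\<^esub> k \<otimes>\<^bsub>K\<^esub> \<zeta> g \<otimes>\<^bsub>K\<^esub> inv\<^bsub>K\<^esub> (\<phi> g c))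
        \<otimes>\<^bsub>K\<^esub> \<phi> g (c \<otimes>\<^bsub>K\<^esub> l \<otimes>\<^bsub>K\<^esub> \<zeta> h \<otimes>\<^bsub>K\<^esub> inv\<^bsub>K\<^esub> (\<phi> h c))"
    if K: "k \<in> carrier K" "l \<in> carrier K" and G: "g \<in> carrier G" "h \<in> carrier G" for k l g h
  proof -
    \<comment> \<open>The factor \<open>(g \<cdot> c)\<inverse>\<close> cancels against \<open>g \<cdot> c\<close>; it remains to move \<open>\<zeta>(g)\<close> past \<open>g \<cdot> l\<close>.\<close>
    have "\<zeta> g \<otimes>\<^bsub>K\<^esub> (\<phi> g l \<otimes>\<^bsub>K\<^esub> y) = \<phi> g l \<otimes>\<^bsub>K\<^esub> (\<zeta> g \<otimes>\<^bsub>K\<^esub> y)" if "y \<in> carrier K" for y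
      using that K G K.centre_commute[OF \<zeta>, of g "\<phi> g l"]
      by (simp add: \<zeta>_closed flip: K.m_assoc)
    then show ?thesis
      using c K G
      by (simp add: \<zeta>_closed \<zeta>_mult act_mult act_inv act_comp K.m_assoc K.inv_mult_cancel)
  qed
  then show "twist c \<zeta> (x \<otimes>\<^bsub>semidirect K G \<phi>\<^esub> y)
      = twist c \<zeta> x \<otimes>\<^bsub>semidirect K G \<phi>\<^esub> twist c \<zeta> y"
    if "x \<in> carrier (semidirect K G \<phi>)" "y \<in> carrier (semidirect K G \<phi>)" for x y
    using that by (auto simp: twist_def semidirect_def)
qed

lemma twist_one:
  assumes "c \<in> carrier K" and "\<zeta> \<one>\<^bsub>G\<^esub> = \<one>\<^bsub>K\<^esub>"
  shows "twist c \<zeta> \<one>\<^bsub>semidirect K G \<phi>\<^esub> = \<one>\<^bsub>semidirect K G \<phi>\<^esub>"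
  using assms by (simp add: twist_def semidirect_def)

lemma twist_inverse:
  assumes c: "c \<in> carrier K" and \<zeta>: "\<And>g. g \<in> carrier G \<Longrightarrow> \<zeta> g \<in> centre K"
    and x: "x \<in> carrier (semidirect K G \<phi>)"
  shows "twist c \<zeta> (twist (inv\<^bsub>K\<^esub> c) (\<lambda>g. inv\<^bsub>K\<^esub> (\<zeta> g)) x) = x"
proof -
  obtain k g where x_eq: "x = (k, g)" and kg: "k \<in> carrier K" "g \<in> carrier G"
    using x by (auto simp: semidirect_def)
  have \<zeta>g: "\<zeta> g \<in> carrier K" "inv\<^bsub>K\<^esub> (\<zeta> g) \<in> centre K"
    using \<zeta>[OF kg(2)] by (auto simp: K.centre_closed K.centre_inv)
  have "inv\<^bsub>K\<^esub> (\<zeta> g) \<otimes>\<^bsub>K\<^esub> (\<phi> g c \<otimes>\<^bsub>K\<^esub> y) = \<phi> g c \<otimes>\<^bsub>K\<^esub> (inv\<^bsub>K\<^esub> (\<zeta> g) \<otimes>\<^bsub>K\<^esub> y)"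
    if "y \<in> carrier K" for y
    using that c kg \<zeta>g K.centre_commute[OF \<zeta>g(2), of "\<phi> g c"] by (simp flip: K.m_assoc)
  then show ?thesis
    using c kg \<zeta>g
    by (simp add: x_eq twist_def act_inv K.m_assoc K.mult_inv_cancel K.inv_mult_cancel)
qed

lemma inv_central_derivation:
  assumes "\<And>g. g \<in> carrier G \<Longrightarrow> \<zeta> g \<in> centre K"
    and "\<And>g h. \<lbrakk>g \<in> carrier G; h \<in> carrier G\<rbrakk> \<Longrightarrow> \<zeta> (g \<otimes>\<^bsub>G\<^esub> h) = \<zeta> g \<otimes>\<^bsub>K\<^esub> \<phi> g (\<zeta> h)"
    and "g \<in> carrier G" "h \<in> carrier G"
  shows "inv\<^bsub>K\<^esub> (\<zeta> (g \<otimes>\<^bsub>G\<^esub> h)) = inv\<^bsub>K\<^esub> (\<zeta> g) \<otimes>\<^bsub>K\<^esub> \<phi> g (inv\<^bsub>K\<^esub> (\<zeta> h))"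
  using assms K.centre_commute[of "\<zeta> g" "\<phi> g (\<zeta> h)"]
  by (simp add: act_inv K.centre_closed flip: K.inv_mult_group)

text \<open>
  Projecting to \<open>Inn K\<close> shows that \<open>d'(g)\<close> and \<open>c d(g) (g \<cdot> c)\<inverse>\<close> differ by a central factor
  \<open>\<zeta>(g)\<close>. Expanding \<open>d(gh)\<close> and \<open>d'(gh)\<close> leaves \<open>\<zeta>(gh) = (g \<cdot> d(h))\<inverse> \<zeta>(g) (g \<cdot> d(h)) (g \<cdot> \<zeta>(h))\<close>,
  and centrality of \<open>\<zeta>(g)\<close> removes the conjugation: this is why \<open>\<zeta>\<close> is a derivation although
  \<open>d\<close> and \<open>d'\<close> take values in a nonabelian group.
\<close>

lemma derivation_rel_Inn_central_factor:
  assumes d: "d \<in> derivations G K \<phi>" and d': "d' \<in> derivations G K \<phi>"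
    and rel: "(\<lambda>g\<in>carrier G. to_Inn K (d g), \<lambda>g\<in>carrier G. to_Inn K (d' g))
      \<in> derivation_rel G (Inn K) (Inn_action K \<phi>)"
  obtains c \<zeta> where "c \<in> carrier K"
    and "\<And>g. g \<in> carrier G \<Longrightarrow> \<zeta> g \<in> centre K"
    and "\<And>g h. \<lbrakk>g \<in> carrier G; h \<in> carrier G\<rbrakk> \<Longrightarrow> \<zeta> (g \<otimes>\<^bsub>G\<^esub> h) = \<zeta> g \<otimes>\<^bsub>K\<^esub> \<phi> g (\<zeta> h)"
    and "\<And>g. g \<in> carrier G \<Longrightarrow> d' g = c \<otimes>\<^bsub>K\<^esub> d g \<otimes>\<^bsub>K\<^esub> \<zeta> g \<otimes>\<^bsub>K\<^esub> inv\<^bsub>K\<^esub> (\<phi> g c)"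
proof -
  obtain C where "C \<in> carrier (Inn K)"
    and "\<And>g. g \<in> carrier G \<Longrightarrow> to_Inn K (d' g)
        = C \<otimes>\<^bsub>Inn K\<^esub> to_Inn K (d g) \<otimes>\<^bsub>Inn K\<^esub> inv\<^bsub>Inn K\<^esub> (Inn_action K \<phi> g C)"
    using rel by (auto simp: derivation_rel_def)
  then obtain c where c: "c \<in> carrier K"
    and to_Inn_d': "\<And>g. g \<in> carrier G \<Longrightarrow> to_Inn K (d' g)
        = to_Inn K c \<otimes>\<^bsub>Inn K\<^esub> to_Inn K (d g) \<otimes>\<^bsub>Inn K\<^esub> inv\<^bsub>Inn K\<^esub> (Inn_action K \<phi> g (to_Inn K c))"
    by (auto simp: K.carrier_Inn)
  interpret q: group_hom K "Inn K" "to_Inn K"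
    by (intro group_hom.intro group_hom_axioms.intro K.group_axioms K.group_Inn K.to_Inn_hom)
  note dc = derivation_closed[OF d] and dc' = derivation_closed[OF d']
  define \<zeta> where "\<zeta> g = inv\<^bsub>K\<^esub> (d g) \<otimes>\<^bsub>K\<^esub> inv\<^bsub>K\<^esub> c \<otimes>\<^bsub>K\<^esub> d' g \<otimes>\<^bsub>K\<^esub> \<phi> g c" for g
  have central: "\<zeta> g \<in> centre K" if g: "g \<in> carrier G" for g
  proof -
    have "to_Inn K (d' g) = to_Inn K (c \<otimes>\<^bsub>K\<^esub> d g \<otimes>\<^bsub>K\<^esub> inv\<^bsub>K\<^esub> (\<phi> g c))"
      using g c dc by (simp add: to_Inn_d' Inn_action_to_Inn)
    then obtain z where z: "z \<in> centre K"
      and d'g: "d' g = z \<otimes>\<^bsub>K\<^esub> (c \<otimes>\<^bsub>K\<^esub> d g \<otimes>\<^bsub>K\<^esub> inv\<^bsub>K\<^esub> (\<phi> g c))"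
      using K.to_Inn_eqD[of "d' g"] g c dc dc' by (metis K.inv_closed K.m_closed act_closed)
    have "\<zeta> g = inv\<^bsub>K\<^esub> (c \<otimes>\<^bsub>K\<^esub> d g) \<otimes>\<^bsub>K\<^esub> (z \<otimes>\<^bsub>K\<^esub> (c \<otimes>\<^bsub>K\<^esub> d g))"
      using g c dc z by (simp add: \<zeta>_def d'g K.inv_mult_group K.m_assoc K.centre_closed)
    also have "\<dots> = z"
      using g c dc z K.centre_commute[OF z, of "c \<otimes>\<^bsub>K\<^esub> d g"]
      by (simp add: K.centre_closed K.inv_mult_cancel)
    finally show ?thesis
      using z by simp
  qed
  have mult: "\<zeta> (g \<otimes>\<^bsub>G\<^esub> h) = \<zeta> g \<otimes>\<^bsub>K\<^esub> \<phi> g (\<zeta> h)" if gh: "g \<in> carrier G" "h \<in> carrier G" for g h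
  proof -
    let ?u = "\<phi> g (inv\<^bsub>K\<^esub> c \<otimes>\<^bsub>K\<^esub> d' h \<otimes>\<^bsub>K\<^esub> \<phi> h c)"
    have u: "?u \<in> carrier K" "\<phi> g (d h) \<in> carrier K" "\<zeta> g \<in> carrier K"
      using gh c dc dc' central K.centre_closed by auto
    have "\<zeta> (g \<otimes>\<^bsub>G\<^esub> h) = inv\<^bsub>K\<^esub> (\<phi> g (d h)) \<otimes>\<^bsub>K\<^esub> \<zeta> g \<otimes>\<^bsub>K\<^esub> ?u"
      using gh c dc dc'
      by (simp add: \<zeta>_def derivation_mult[OF d] derivation_mult[OF d'] act_mult act_inv act_comp
          K.inv_mult_group K.m_assoc K.mult_inv_cancel)
    also have "\<dots> = \<zeta> g \<otimes>\<^bsub>K\<^esub> (inv\<^bsub>K\<^esub> (\<phi> g (d h)) \<otimes>\<^bsub>K\<^esub> ?u)"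
      using u K.centre_commute[OF central[OF gh(1)], of "inv\<^bsub>K\<^esub> (\<phi> g (d h))"]
      by (simp flip: K.m_assoc)
    also have "\<dots> = \<zeta> g \<otimes>\<^bsub>K\<^esub> \<phi> g (\<zeta> h)"
      using gh c dc dc' by (simp add: \<zeta>_def[of h] act_mult act_inv K.m_assoc)
    finally show ?thesis .
  qed
  have "d' g = c \<otimes>\<^bsub>K\<^esub> d g \<otimes>\<^bsub>K\<^esub> \<zeta> g \<otimes>\<^bsub>K\<^esub> inv\<^bsub>K\<^esub> (\<phi> g c)" if "g \<in> carrier G" for g
    using that c dc dc' by (simp add: \<zeta>_def K.m_assoc K.mult_inv_cancel)
  with c central mult show thesis
    by (rule that)
qed

end

section \<open>Functoriality of the classifying space\<close>

lemma nerve_face_map: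
  assumes "f \<in> hom G H" and "\<sigma> \<in> lists (carrier G)" and "i \<le> length \<sigma>"
  shows "nerve_face H i (map f \<sigma>) = map f (nerve_face G i \<sigma>)"
proof -
  have "f (\<sigma> ! (i - 1) \<otimes>\<^bsub>G\<^esub> \<sigma> ! i) = f (\<sigma> ! (i - 1)) \<otimes>\<^bsub>H\<^esub> f (\<sigma> ! i)" if "i \<noteq> 0" "i \<noteq> length \<sigma>"
  proof -
    have "\<sigma> ! (i - 1) \<in> carrier G" "\<sigma> ! i \<in> carrier G"
      using assms that by auto
    then show ?thesis
      by (rule hom_mult[OF assms(1)])
  qed
  then show ?thesis
    using assms(3) by (auto simp: nerve_face_def map_tl map_butlast take_map drop_map)
qed

lemma realization_step_map:
  assumes f: "f \<in> hom G H" "f \<one>\<^bsub>G\<^esub> = \<one>\<^bsub>H\<^esub>" and "realization_step G x y"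
  shows "realization_step H (apfst (map f) x) (apfst (map f) y)"
  using assms(3)
proof cases
  case (face \<sigma> n i t)
  then have "realization_step H (nerve_face H i (map f \<sigma>), t) (map f \<sigma>, simplical_face i t)"
    using f(1) by (intro realization_step.face) (auto simp: hom_in_carrier)
  then show ?thesis
    using face by (simp add: nerve_face_map[OF f(1)])
next
  case (degeneracy \<sigma> n i t)
  then have "realization_step H (nerve_degeneracy H i (map f \<sigma>), t) (map f \<sigma>, simplex_codegeneracy i t)"
    using f(1) by (intro realization_step.degeneracy) (auto simp: hom_in_carrier)
  then show ?thesis
    using degeneracy f(2) by (simp add: nerve_degeneracy_def take_map drop_map)
qed

lemma realization_class_cong:
  "equivclp (realization_step G) x y \<Longrightarrow> realization_class G x = realization_class G y"
  unfolding realization_class_def by (blast intro: equivclp_trans equivclp_sym)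

text \<open>
  A homomorphism commutes with faces and degeneracies, hence preserves the equivalence relation of
  the realization; the union in the definition of \<^const>\<open>classifying_map\<close> therefore runs over
  copies of one class.
\<close>

lemma classifying_map_realization_class:
  assumes "f \<in> hom G H" "f \<one>\<^bsub>G\<^esub> = \<one>\<^bsub>H\<^esub>"
  shows "classifying_map H f (realization_class G x) = realization_class H (apfst (map f) x)"
proof -
  have "equivclp (realization_step H) (apfst (map f) x) (apfst (map f) y)"
    if "equivclp (realization_step G) x y" for y
    using that
  proof (induction rule: equivclp_induct)
    case (step y z)
    then show ?case
      using realization_step_map[OF assms] by (metis equivclp_into_equivclp)
  qed simp
  then have eq: "realization_class H (apfst (map f) y) = realization_class H (apfst (map f) x)"
    if "y \<in> realization_class G x" for y
    using that realization_class_cong[of H "apfst (map f) x" "apfst (map f) y"]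
    by (simp add: realization_class_def[of G])
  have "realization_class G x \<noteq> {}"
    unfolding realization_class_def by (blast intro: equivclp_refl)
  note SUP_eq_const[OF this eq]
  moreover have "classifying_map H f (realization_class G x)
      = (\<Union>y\<in>realization_class G x. realization_class H (apfst (map f) y))"
    by (auto simp: classifying_map_def apfst_def map_prod_def)
  ultimately show ?thesis
    by simp
qed

lemma topspace_classifying_space:
  "topspace (classifying_space G) = realization_class G ` topspace (nerve_cells G)"
  by (simp add: classifying_space_def topspace_quotient_topology)

lemma classifying_map_comp:
  assumes "f \<in> hom G H" "f \<one>\<^bsub>G\<^esub> = \<one>\<^bsub>H\<^esub>" "f' \<in> hom H L" "f' \<one>\<^bsub>H\<^esub> = \<one>\<^bsub>L\<^esub>"
    and "f'' \<in> hom G L" "f'' \<one>\<^bsub>G\<^esub> = \<one>\<^bsub>L\<^esub>"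
    and eq: "\<And>g. g \<in> carrier G \<Longrightarrow> f' (f g) = f'' g"
    and X: "X \<in> topspace (classifying_space G)"
  shows "classifying_map L f' (classifying_map H f X) = classifying_map L f'' X"
proof -
  obtain \<sigma> t where X_eq: "X = realization_class G (\<sigma>, t)" and \<sigma>: "\<sigma> \<in> lists (carrier G)"
    using X by (auto simp: topspace_classifying_space nerve_cells_def)
  have "map f' (map f \<sigma>) = map f'' \<sigma>"
    using \<sigma> eq by auto
  then show ?thesis
    using assms(1-6) by (simp add: X_eq classifying_map_realization_class del: map_map)
qed

lemma classifying_map_id:
  assumes "X \<in> topspace (classifying_space G)"
  shows "classifying_map G (\<lambda>g. g) X = X"
  using assms classifying_map_realization_class[of "\<lambda>g. g" G G]
  by (auto simp: topspace_classifying_space hom_def)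

lemma continuous_map_nerve_cells:
  assumes "f \<in> hom G H"
  shows "continuous_map (nerve_cells G) (nerve_cells H) (apfst (map f))"
  unfolding continuous_map_def
proof (intro conjI allI impI)
  show "apfst (map f) \<in> topspace (nerve_cells G) \<rightarrow> topspace (nerve_cells H)"
    using hom_in_carrier[OF assms] by (auto simp: nerve_cells_def)
  fix U assume U: "openin (nerve_cells H) U"
  show "openin (nerve_cells G) {x \<in> topspace (nerve_cells G). apfst (map f) x \<in> U}"
    unfolding nerve_cells_def openin_sum_topology
  proof (intro conjI ballI)
    fix \<sigma> assume \<sigma>: "\<sigma> \<in> lists (carrier G)"
    let ?S = "subtopology (powertop_real UNIV) (standard_simplex (length \<sigma>)) :: (nat \<Rightarrow> real) topology"
    have "map f \<sigma> \<in> lists (carrier H)"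
      using \<sigma> hom_in_carrier[OF assms] by auto
    moreover have "\<forall>\<tau>\<in>lists (carrier H). openin (subtopology (powertop_real UNIV)
        (standard_simplex (length \<tau>))) {t. (\<tau>, t) \<in> U}"
      using U by (simp add: nerve_cells_def openin_sum_topology)
    ultimately have "openin (subtopology (powertop_real UNIV)
        (standard_simplex (length (map f \<sigma>)))) {t. (map f \<sigma>, t) \<in> U}"
      by (rule bspec[rotated])
    then have "openin ?S {t. (map f \<sigma>, t) \<in> U}"
      by simp
    moreover from openin_subset[OF this]
    have "{t. (map f \<sigma>, t) \<in> U} = {t \<in> topspace ?S. (map f \<sigma>, t) \<in> U}"
      by auto
    ultimately show "openin ?S {t. (\<sigma>, t) \<in> {x \<in> topspace (sum_topology (\<lambda>\<sigma>. subtopology (powertop_real UNIV)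
        (standard_simplex (length \<sigma>))) (lists (carrier G))). apfst (map f) x \<in> U}}"
      using \<sigma> by simp
  qed auto
qed

lemma continuous_map_classifying_map:
  assumes "f \<in> hom G H" "f \<one>\<^bsub>G\<^esub> = \<one>\<^bsub>H\<^esub>"
  shows "continuous_map (classifying_space G) (classifying_space H) (classifying_map H f)"
  unfolding classifying_space_def
proof (rule continuous_compose_quotient_map[OF quotient_map_quotient_topology])
  have "continuous_map (nerve_cells G) (quotient_topology (nerve_cells H) (realization_class H))
      (realization_class H \<circ> apfst (map f))"
    by (rule continuous_map_compose[OF continuous_map_nerve_cells[OF assms(1)]
          quotient_imp_continuous_map[OF quotient_map_quotient_topology]])
  then show "continuous_map (nerve_cells G) (quotient_topology (nerve_cells H) (realization_class H))
      (classifying_map H f \<circ> realization_class G)"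
    by (rule continuous_map_eq) (simp add: classifying_map_realization_class[OF assms])
qed

section \<open>Parametrized LS-category under fibrewise domination\<close>

text \<open>
  Under postcomposition with \<open>h\<close>, the preimage of the subbasic set of maps taking \<open>C\<close> into \<open>U\<close> is
  the subbasic set of maps taking \<open>C\<close> into the preimage of \<open>U\<close> under \<open>h\<close>.
\<close>

lemma continuous_map_compact_open_postcomp:
  assumes h: "continuous_map X Y h"
  shows "continuous_map (compact_open_topology A X) (compact_open_topology A Y)
    (\<lambda>\<alpha>. restrict (h \<circ> \<alpha>) (topspace A))"
proof -
  let ?F = "\<lambda>\<alpha>. restrict (h \<circ> \<alpha>) (topspace A)"
  let ?B = "\<lambda>Z. {{f. f ` C \<subseteq> U} | C U. compactin A C \<and> openin Z U}"
  let ?M = "\<lambda>Z. {f \<in> extensional (topspace A). continuous_map A Z f}"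
  \<comment> \<open>The empty compact set contributes the whole function type to the subbasis.\<close>
  have "UNIV \<in> ?B Z" for Z :: "'z topology"
    by (rule CollectI, rule exI[of _ "{}"], rule exI[of _ "{}"]) simp
  then have UN: "\<Union> (?B Z) = UNIV" for Z :: "'z topology"
    by blast
  have "continuous_map (compact_open_topology A X) (topology_generated_by (?B Y)) ?F"
  proof (rule continuous_on_generated_topo)
    fix W assume "W \<in> ?B Y"
    then obtain C U where W: "W = {f. f ` C \<subseteq> U}" and C: "compactin A C" and U: "openin Y U"
      by auto
    let ?V = "{x \<in> topspace X. h x \<in> U}"
    have "openin (compact_open_topology A X) ({f. f ` C \<subseteq> ?V} \<inter> ?M X)"
      unfolding compact_open_topology_def
      by (rule openin_subtopology_Int, rule topology_generated_by_Basis)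
        (use C U h in \<open>blast intro: openin_continuous_map_preimage\<close>)
    moreover have "?F -` W \<inter> topspace (compact_open_topology A X) = {f. f ` C \<subseteq> ?V} \<inter> ?M X"
      using compactin_subset_topspace[OF C]
      by (auto simp: W compact_open_topology_def UN continuous_map_def image_subset_iff subset_iff)
    ultimately show "openin (compact_open_topology A X) (?F -` W \<inter> topspace (compact_open_topology A X))"
      by simp
  qed (simp add: UN)
  moreover have "?F \<alpha> \<in> ?M Y" if "\<alpha> \<in> topspace (compact_open_topology A X)" for \<alpha>
  proof -
    have "continuous_map A Y (h \<circ> \<alpha>)"
      using that h by (auto simp: compact_open_topology_def intro: continuous_map_compose)
    then have "continuous_map A Y (?F \<alpha>)"
      by (rule continuous_map_eq) simp
    then show ?thesis
      by simp
  qed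
  ultimately show ?thesis
    unfolding compact_open_topology_def[of A Y] by (auto simp: continuous_map_in_subtopology)
qed

lemma topspace_compact_open_topology:
  "topspace (compact_open_topology A X) \<subseteq> {f \<in> extensional (topspace A). continuous_map A X f}"
  by (auto simp: compact_open_topology_def)

lemma continuous_map_fibrewise_postcomp:
  assumes h: "continuous_map X Y h"
    and r: "\<And>x. x \<in> topspace X \<Longrightarrow> r' (h x) = r x"
    and s: "\<And>x. x \<in> topspace X \<Longrightarrow> h (s (r x)) = s' (r x)"
  shows "continuous_map (fibrewise_path_space X r s) (fibrewise_path_space Y r' s')
    (\<lambda>\<alpha>. restrict (h \<circ> \<alpha>) {0..1})"
  unfolding fibrewise_path_space_def continuous_map_in_subtopology
proof
  show "continuous_map (subtopology (compact_open_topology (top_of_set {0..1}) X)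
        {\<alpha>. (\<forall>t\<in>{0..1}. r (\<alpha> t) = r (\<alpha> 0)) \<and> \<alpha> 0 = s (r (\<alpha> 0))})
      (compact_open_topology (top_of_set {0..1}) Y) (\<lambda>\<alpha>. restrict (h \<circ> \<alpha>) {0..1::real})"
    using continuous_map_from_subtopology[OF continuous_map_compact_open_postcomp[OF h, of "top_of_set {0..1::real}"]]
    by simp
  have fibrewise: "r' (h (\<alpha> t)) = r' (h (\<alpha> 0))" "h (\<alpha> 0) = s' (r' (h (\<alpha> 0)))"
    if \<alpha>: "\<alpha> \<in> topspace (compact_open_topology (top_of_set {0..1}) X)"
      and fib: "\<forall>t\<in>{0..1}. r (\<alpha> t) = r (\<alpha> 0)" "\<alpha> 0 = s (r (\<alpha> 0))" and t: "t \<in> {0..1}"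
    for \<alpha> and t :: real
  proof -
    have X: "\<alpha> u \<in> topspace X" if "u \<in> {0..1}" for u
    proof -
      have "continuous_map (top_of_set {0..1}) X \<alpha>"
        using subsetD[OF topspace_compact_open_topology \<alpha>] by simp
      from continuous_map_image_subset_topspace[OF this] show ?thesis
        using that by auto
    qed
    have X0: "\<alpha> 0 \<in> topspace X"
      by (rule X) simp
    show "r' (h (\<alpha> t)) = r' (h (\<alpha> 0))"
      unfolding r[OF X[OF t]] r[OF X0] using fib(1) t by blast
    show "h (\<alpha> 0) = s' (r' (h (\<alpha> 0)))"
      using s[OF X0] unfolding fib(2)[symmetric] r[OF X0] .
  qed
  show "(\<lambda>\<alpha>. restrict (h \<circ> \<alpha>) {0..1}) \<in> topspace (subtopology (compact_open_topology (top_of_set {0..1}) X)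
        {\<alpha>. (\<forall>t\<in>{0..1}. r (\<alpha> t) = r (\<alpha> 0)) \<and> \<alpha> 0 = s (r (\<alpha> 0))})
      \<rightarrow> {\<alpha>. (\<forall>t\<in>{0..1::real}. r' (\<alpha> t) = r' (\<alpha> 0)) \<and> \<alpha> 0 = s' (r' (\<alpha> 0))}"
  proof
    fix \<alpha> :: "real \<Rightarrow> 'a"
    assume "\<alpha> \<in> topspace (subtopology (compact_open_topology (top_of_set {0..1}) X)
        {\<alpha>. (\<forall>t\<in>{0..1}. r (\<alpha> t) = r (\<alpha> 0)) \<and> \<alpha> 0 = s (r (\<alpha> 0))})"
    then have \<alpha>: "\<alpha> \<in> topspace (compact_open_topology (top_of_set {0..1}) X)"
      "\<forall>t\<in>{0..1}. r (\<alpha> t) = r (\<alpha> 0)" "\<alpha> 0 = s (r (\<alpha> 0))"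
      unfolding topspace_subtopology by blast+
    have "r' (restrict (h \<circ> \<alpha>) {0..1} t) = r' (restrict (h \<circ> \<alpha>) {0..1} 0)" if "t \<in> {0..1}" for t
      using fibrewise(1)[OF \<alpha> that] that by simp
    moreover have "restrict (h \<circ> \<alpha>) {0..1} 0 = s' (r' (restrict (h \<circ> \<alpha>) {0..1} 0))"
      using fibrewise(2)[OF \<alpha>, of 0] by simp
    ultimately show "restrict (h \<circ> \<alpha>) {0..1}
        \<in> {\<alpha>. (\<forall>t\<in>{0..1}. r' (\<alpha> t) = r' (\<alpha> 0)) \<and> \<alpha> 0 = s' (r' (\<alpha> 0))}"
      by blast
  qed
qed

text \<open>
  The covers witnessing \<^const>\<open>secat\<close> pull back along \<open>k\<close>, so only the local sections have to be
  carried over.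
\<close>

lemma secat_le_of_pullback:
  assumes k: "continuous_map Y' Y k"
    and transfer: "\<And>U \<sigma>. \<lbrakk>continuous_map (subtopology Y U) E \<sigma>; \<And>y. y \<in> U \<Longrightarrow> q (\<sigma> y) = y\<rbrakk> \<Longrightarrow>
      \<exists>\<tau>. continuous_map (subtopology Y' {y \<in> topspace Y'. k y \<in> U}) E' \<tau> \<and>
        (\<forall>y\<in>{y \<in> topspace Y'. k y \<in> U}. q' (\<tau> y) = y)"
  shows "secat E' Y' q' \<le> secat E Y q"
  unfolding secat_def
proof (rule Inf_superset_mono, rule Collect_mono, rule impI, elim exE conjE)
  fix m n and U :: "nat \<Rightarrow> 'b set"
  assume m: "m = enat n" and cover: "topspace Y = (\<Union>i\<le>n. U i)"
    and U: "\<forall>i\<le>n. openin Y (U i) \<and>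
      (\<exists>s. continuous_map (subtopology Y (U i)) E s \<and> (\<forall>y\<in>U i. q (s y) = y))"
  let ?V = "\<lambda>i. {y \<in> topspace Y'. k y \<in> U i}"
  have "topspace Y' = (\<Union>i\<le>n. ?V i)"
  proof -
    have "k y \<in> (\<Union>i\<le>n. U i)" if "y \<in> topspace Y'" for y
      using continuous_map_image_subset_topspace[OF k] that unfolding cover by blast
    then show ?thesis
      by blast
  qed
  moreover have "openin Y' (?V i) \<and>
      (\<exists>s. continuous_map (subtopology Y' (?V i)) E' s \<and> (\<forall>y\<in>?V i. q' (s y) = y))" if i: "i \<le> n" for i
  proof
    show "openin Y' (?V i)"
      using U i by (intro openin_continuous_map_preimage[OF k]) blast
    obtain \<sigma> where "continuous_map (subtopology Y (U i)) E \<sigma>" "\<And>y. y \<in> U i \<Longrightarrow> q (\<sigma> y) = y"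
      using U i by blast
    then show "\<exists>s. continuous_map (subtopology Y' (?V i)) E' s \<and> (\<forall>y\<in>?V i. q' (s y) = y)"
      by (rule transfer)
  qed
  ultimately show "\<exists>n. m = enat n \<and> (\<exists>V. topspace Y' = (\<Union>i\<le>n. V i) \<and> (\<forall>i\<le>n. openin Y' (V i) \<and>
      (\<exists>s. continuous_map (subtopology Y' (V i)) E' s \<and> (\<forall>y\<in>V i. q' (s y) = y))))"
    using m by (intro exI[of _ n] conjI exI[of _ ?V]) simp_all
qed

text \<open>
  A local section \<open>\<sigma>\<close> of \<open>ev\<^sub>1\<close> over \<open>U\<close> sends \<open>x\<close> to a fibrewise path ending at \<open>x\<close>. The path
  \<open>h \<circ> \<sigma>(k(y))\<close> then ends at \<open>h(k(y)) = y\<close>, and it starts on the section \<open>s'\<close> because \<open>h\<close> maps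
  \<open>s\<close> to \<open>s'\<close>. In particular, equality holds for a homeomorphism over the base that matches the
  sections.
\<close>

lemma parametrized_cat_le_of_domination:
  assumes h: "continuous_map X Y h" and k: "continuous_map Y X k"
    and hk: "\<And>y. y \<in> topspace Y \<Longrightarrow> h (k y) = y"
    and r: "\<And>x. x \<in> topspace X \<Longrightarrow> r' (h x) = r x"
    and s: "\<And>x. x \<in> topspace X \<Longrightarrow> h (s (r x)) = s' (r x)"
  shows "parametrized_cat Y r' s' \<le> parametrized_cat X r s"
  unfolding parametrized_cat_def
proof (rule secat_le_of_pullback[OF k])
  let ?P = "fibrewise_path_space X r s" and ?Q = "fibrewise_path_space Y r' s'"
  let ?h = "\<lambda>\<alpha>. restrict (h \<circ> \<alpha>) {0..1::real}"
  fix U \<sigma>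
  assume \<sigma>: "continuous_map (subtopology X U) ?P \<sigma>" "\<And>x. x \<in> U \<Longrightarrow> \<sigma> x 1 = x"
  let ?V = "{y \<in> topspace Y. k y \<in> U}"
  have "continuous_map (subtopology Y ?V) (subtopology X U) k"
    by (auto simp: continuous_map_in_subtopology continuous_map_from_subtopology[OF k])
  moreover have "continuous_map ?P ?Q ?h"
    by (intro continuous_map_fibrewise_postcomp h r s)
  ultimately have "continuous_map (subtopology Y ?V) ?Q (?h \<circ> (\<sigma> \<circ> k))"
    using \<sigma>(1) by (intro continuous_map_compose)
  moreover have "\<forall>y\<in>?V. (?h \<circ> (\<sigma> \<circ> k)) y 1 = y"
    by (simp add: \<sigma>(2) hk)
  ultimately show "\<exists>\<tau>. continuous_map (subtopology Y ?V) ?Q \<tau> \<and> (\<forall>y\<in>?V. \<tau> y 1 = y)"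
    by blast
qed

section \<open>Invariance of the complexity of a derivation\<close>

context group_acting_on_group
begin

lemma snd_semidirect_hom: "snd \<in> hom (semidirect K G \<phi>) G"
  by (auto simp: hom_def semidirect_def)

lemma section_hom:
  assumes "d \<in> derivations G K \<phi>"
  shows "(\<lambda>g. (d g, g)) \<in> hom G (semidirect K G \<phi>)"
  using derivation_closed[OF assms] derivation_mult[OF assms] by (auto simp: hom_def semidirect_def)

lemma derivation_one:
  assumes "d \<one>\<^bsub>G\<^esub> \<in> carrier K"
    and "\<And>g h. \<lbrakk>g \<in> carrier G; h \<in> carrier G\<rbrakk> \<Longrightarrow> d (g \<otimes>\<^bsub>G\<^esub> h) = d g \<otimes>\<^bsub>K\<^esub> \<phi> g (d h)"
  shows "d \<one>\<^bsub>G\<^esub> = \<one>\<^bsub>K\<^esub>"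
  using assms(2)[of "\<one>\<^bsub>G\<^esub>" "\<one>\<^bsub>G\<^esub>"] assms(1) by (simp add: K.l_cancel_one)

text \<open>
  The automorphism \<open>F\<close> of \<open>K \<rtimes> G\<close> given by \<^const>\<open>twist\<close> and its inverse induce a domination over
  \<open>BG\<close>. One inequality is enough, since being cohomologous in \<open>Inn K\<close> is symmetric.
\<close>

lemma tc_le_of_derivation_rel_Inn:
  assumes d: "d \<in> derivations G K \<phi>" and d': "d' \<in> derivations G K \<phi>"
    and rel: "(\<lambda>g\<in>carrier G. to_Inn K (d g), \<lambda>g\<in>carrier G. to_Inn K (d' g))
      \<in> derivation_rel G (Inn K) (Inn_action K \<phi>)"
  shows "tc G K \<phi> d' \<le> tc G K \<phi> d"
proof -
  let ?S = "semidirect K G \<phi>"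
  obtain c \<zeta> where c: "c \<in> carrier K"
    and \<zeta>: "\<And>g. g \<in> carrier G \<Longrightarrow> \<zeta> g \<in> centre K"
    and \<zeta>_mult: "\<And>g h. \<lbrakk>g \<in> carrier G; h \<in> carrier G\<rbrakk> \<Longrightarrow> \<zeta> (g \<otimes>\<^bsub>G\<^esub> h) = \<zeta> g \<otimes>\<^bsub>K\<^esub> \<phi> g (\<zeta> h)"
    and d'_eq: "\<And>g. g \<in> carrier G \<Longrightarrow> d' g = c \<otimes>\<^bsub>K\<^esub> d g \<otimes>\<^bsub>K\<^esub> \<zeta> g \<otimes>\<^bsub>K\<^esub> inv\<^bsub>K\<^esub> (\<phi> g c)"
    using derivation_rel_Inn_central_factor[OF assms] by blast
  have \<zeta>_one: "\<zeta> \<one>\<^bsub>G\<^esub> = \<one>\<^bsub>K\<^esub>"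
    by (rule derivation_one) (auto simp: \<zeta>_mult K.centre_closed[OF \<zeta>])
  define F where "F = twist c \<zeta>"
  define F' where "F' = twist (inv\<^bsub>K\<^esub> c) (\<lambda>g. inv\<^bsub>K\<^esub> (\<zeta> g))"
  have F: "F \<in> hom ?S ?S" "F \<one>\<^bsub>?S\<^esub> = \<one>\<^bsub>?S\<^esub>"
    unfolding F_def by (simp_all add: twist_hom[OF c \<zeta> \<zeta>_mult] twist_one c \<zeta>_one)
  have F': "F' \<in> hom ?S ?S" "F' \<one>\<^bsub>?S\<^esub> = \<one>\<^bsub>?S\<^esub>"
    unfolding F'_def using c inv_central_derivation[OF \<zeta> \<zeta>_mult]
    by (auto simp: twist_one \<zeta>_one intro!: twist_hom K.centre_inv \<zeta>)
  have FF': "F (F' x) = x" if "x \<in> carrier ?S" for x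
    unfolding F_def F'_def by (rule twist_inverse[OF c \<zeta> that])
  note p = snd_semidirect_hom
  have p1: "snd \<one>\<^bsub>?S\<^esub> = \<one>\<^bsub>G\<^esub>"
    by (simp add: semidirect_def)
  have section_one: "(e \<one>\<^bsub>G\<^esub>, \<one>\<^bsub>G\<^esub>) = \<one>\<^bsub>?S\<^esub>" if "e \<in> derivations G K \<phi>" for e
    using derivation_one[of e] derivation_closed[OF that] derivation_mult[OF that]
    by (simp add: semidirect_def)
  have id_hom: "(\<lambda>x. x) \<in> hom ?S ?S"
    by (simp add: hom_def)
  let ?s = "\<lambda>e. classifying_map ?S (\<lambda>g. (e g, g))"
  show ?thesis
    unfolding tc_def
  proof (rule parametrized_cat_le_of_domination)
    show "continuous_map (classifying_space ?S) (classifying_space ?S) (classifying_map ?S F)"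
      "continuous_map (classifying_space ?S) (classifying_space ?S) (classifying_map ?S F')"
      by (intro continuous_map_classifying_map F F')+
    show "classifying_map ?S F (classifying_map ?S F' X) = X"
      if "X \<in> topspace (classifying_space ?S)" for X
      using classifying_map_comp[OF F' F, of "\<lambda>x. x"] classifying_map_id[OF that] FF' id_hom that
      by simp
    show "classifying_map G snd (classifying_map ?S F X) = classifying_map G snd X"
      if "X \<in> topspace (classifying_space ?S)" for X
      by (rule classifying_map_comp[OF F p p1 p p1 _ that]) (auto simp: F_def twist_def)
    show "classifying_map ?S F (?s d (classifying_map G snd X)) = ?s d' (classifying_map G snd X)"
      if "X \<in> topspace (classifying_space ?S)" for X
    proof (rule classifying_map_comp[OF section_hom[OF d] section_one[OF d] F
            section_hom[OF d'] section_one[OF d']])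
      show "F (d g, g) = (d' g, g)" if "g \<in> carrier G" for g
        using that by (simp add: F_def twist_def d'_eq)
      show "classifying_map G snd X \<in> topspace (classifying_space G)"
        using continuous_map_image_subset_topspace[OF continuous_map_classifying_map[OF p p1]] that
        by blast
    qed
  qed
qed

end

theorem corollary3p20:
  fixes G :: "('g, 'm) monoid_scheme" and K :: "('k, 'n) monoid_scheme"
    and \<phi> :: "'g \<Rightarrow> 'k \<Rightarrow> 'k" and d d' :: "'g \<Rightarrow> 'k"
  assumes "group G" and "group K" and "\<phi> \<in> hom G (AutoGroup K)"
    and "d \<in> derivations G K \<phi>" and "d' \<in> derivations G K \<phi>"
    and "\<exists>\<Omega> \<in> ker_brauer_mod_centre G K \<phi>.
           q_star G K \<phi> (H1_class G K \<phi> d) \<in> \<Omega> \<and> q_star G K \<phi> (H1_class G K \<phi> d') \<in> \<Omega>"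
  shows "tc G K \<phi> d = tc G K \<phi> d'"
proof -
  interpret group_acting_on_group G K \<phi>
    by (intro group_acting_on_group.intro group_acting_on_group_axioms.intro assms(1-3))
  obtain \<Omega> where "\<Omega> \<in> ker_brauer_mod_centre G K \<phi>"
    "q_star G K \<phi> (H1_class G K \<phi> d) \<in> \<Omega>" "q_star G K \<phi> (H1_class G K \<phi> d') \<in> \<Omega>"
    using assms(6) by blast
  then show ?thesis
    using assms(4,5)
    by (intro antisym tc_le_of_derivation_rel_Inn same_orbit_imp_derivation_rel_Inn)
qed

end
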